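(* Let $G$ be a connected graph and let $x$ be a vertex of $G$ that is not a cut vertex. Then $$\mathrm{gp}_{\rm t}(G)-1\le \mathrm{gp}_{\rm t}(G-x)\le \mathrm{gp}_{\rm t}(G)+\deg_G(x).$$ Moreover, if $x$ is a simplicial vertex, then $\mathrm{gp}_{\rm t}(G-x)\le \mathrm{gp}_{\rm t}(G)+\deg_G(x)-1$. All three bounds are sharp, i.e., each of them holds with equality for some connected graph $G$ and some vertex $x$ satisfying the respective hypotheses.
   Context: All graphs are finite, simple and connected. For a graph $G$ and $Z\subseteq V(G)$, two vertices $p,q\in V(G)$ are $Z$-positionable if no shortest $p,q$-path in $G$ has an internal vertex in $Z$. $Z$ is a total general position set if every two vertices of $V(G)$ are $Z$-positionable, and $\mathrm{gp}_{\rm t}(G)$ is the maximum cardinality of a total general position set of $G$. A vertex is simplicial if its neighbourhood induces a complete graph. $\deg_G(x)$ is the degree of $x$ and $G-x$ is the graph obtained by deleting $x$ and its incident edges. *)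

theory Defs
  imports "Graph_Theory.Graph_Theory"
begin

text \<open>
  Finite simple graphs are the symmetric digraphs of the locale \<^locale>\<open>graph\<close>: an undirected
  edge is a pair of opposite arcs, so the degree of a vertex is its \<^const>\<open>out_degree\<close>.
\<close>

definition shortest_path :: "('a, 'b) pre_digraph \<Rightarrow> 'a \<Rightarrow> 'a vwalk \<Rightarrow> 'a \<Rightarrow> bool" where
  "shortest_path G p w q \<longleftrightarrow>
     vpath w G \<and> hd w = p \<and> last w = q \<and>
     (\<forall>w'. vpath w' G \<and> hd w' = p \<and> last w' = q \<longrightarrow> vwalk_length w \<le> vwalk_length w')"

definition internal_verts :: "'a vwalk \<Rightarrow> 'a set" where
  "internal_verts w = set w - {hd w, last w}"

definition positionable :: "('a, 'b) pre_digraph \<Rightarrow> 'a set \<Rightarrow> 'a \<Rightarrow> 'a \<Rightarrow> bool" where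
  "positionable G Z p q \<longleftrightarrow> (\<forall>w. shortest_path G p w q \<longrightarrow> internal_verts w \<inter> Z = {})"

definition total_general_position :: "('a, 'b) pre_digraph \<Rightarrow> 'a set \<Rightarrow> bool" where
  "total_general_position G Z \<longleftrightarrow>
     Z \<subseteq> verts G \<and> (\<forall>p \<in> verts G. \<forall>q \<in> verts G. positionable G Z p q)"

definition gp_t :: "('a, 'b) pre_digraph \<Rightarrow> nat" where
  "gp_t G = Max (card ` {Z. total_general_position G Z})"

definition neighbourhood :: "('a, 'b) pre_digraph \<Rightarrow> 'a \<Rightarrow> 'a set" where
  "neighbourhood G v = {u \<in> verts G. v \<rightarrow>\<^bsub>G\<^esub> u}"

definition simplicial :: "('a, 'b) pre_digraph \<Rightarrow> 'a \<Rightarrow> bool" where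
  "simplicial G v \<longleftrightarrow> v \<in> verts G \<and> (\<exists>n. complete_digraph n (G \<restriction> neighbourhood G v))"

text \<open>
  A cut vertex separates two other vertices of its component. In particular the vertex of a
  one-vertex graph is not a cut vertex, although \<^const>\<open>Digraph_Component.connected\<close> does not
  hold of the graph without vertices.
\<close>

definition cut_vertex :: "('a, 'b) pre_digraph \<Rightarrow> 'a \<Rightarrow> bool" where
  "cut_vertex G x \<longleftrightarrow>
     x \<in> verts G \<and>
     (\<exists>u \<in> verts G - {x}. \<exists>v \<in> verts G - {x}.
        u \<rightarrow>\<^sup>*\<^bsub>G\<^esub> v \<and> \<not> u \<rightarrow>\<^sup>*\<^bsub>pre_digraph.del_vert G x\<^esub> v)"

end

theory Submission
  imports Defs
begin

text \<open>
  A vertex with two non-adjacent neighbours is the middle of a shortest path of length two, whereas a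
  path through a simplicial vertex can be shortened by bypassing it. Hence the total general position
  sets are exactly the sets of simplicial vertices, and \<open>gp_t G\<close> counts the simplicial vertices of
  \<open>G\<close>. Deleting \<open>x\<close> keeps the other simplicial vertices simplicial and creates new ones only among
  the neighbours of \<open>x\<close>. Equality holds for \<open>K\<^sub>2\<close>, for \<open>C\<^sub>4\<close>, and for an end vertex of \<open>P\<^sub>3\<close>,
  respectively.
\<close>

section \<open>Simplicial vertices in terms of adjacency\<close>

text \<open>The arcs of the induced subgraph are exactly the adjacencies of \<open>G\<close> between
  neighbours of \<open>v\<close>, and completeness asks that these be all pairs of distinct
  neighbours. One inclusion holds since \<open>G\<close> has no loops; the other is the condition on
  the right. The order \<open>n\<close> is simply the number of neighbours.\<close>

lemma simplicial_iff:
  assumes "graph G"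
  shows "simplicial G v \<longleftrightarrow>
    v \<in> verts G \<and> (\<forall>a b. v \<rightarrow>\<^bsub>G\<^esub> a \<longrightarrow> v \<rightarrow>\<^bsub>G\<^esub> b \<longrightarrow> a \<noteq> b \<longrightarrow> a \<rightarrow>\<^bsub>G\<^esub> b)"
proof -
  interpret graph G by fact
  let ?N = "neighbourhood G v"
  have N: "a \<in> ?N \<longleftrightarrow> v \<rightarrow>\<^bsub>G\<^esub> a" for a
    using adj_in_verts(2) by (auto simp: neighbourhood_def)
  have fin: "finite ?N"
    by (rule finite_subset[OF _ finite_verts]) (auto simp: neighbourhood_def)
  have ends: "arcs_ends (G \<restriction> ?N) = {(a, b). a \<in> ?N \<and> b \<in> ?N \<and> a \<rightarrow>\<^bsub>G\<^esub> b}"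
    by (auto simp: arcs_ends_conv)
  \<comment> \<open>\<open>complete_digraph\<close> includes being a graph, so this has to be
    established for the induced subgraph.\<close>
  have dg: "digraph (G \<restriction> ?N)"
    using fin by unfold_locales (auto simp: no_loops intro: no_multi_arcs)
  have "symmetric (G \<restriction> ?N)"
    using arcs_ends_symmetric[OF sym_arcs] by (auto simp: symmetric_def ends intro!: symI)
  with dg have gr: "graph (G \<restriction> ?N)"
    by (rule digraph.graphI)
  have "simplicial G v \<longleftrightarrow>
      v \<in> verts G \<and> (\<forall>a b. a \<in> ?N \<and> b \<in> ?N \<and> a \<rightarrow>\<^bsub>G\<^esub> b \<longleftrightarrow> a \<in> ?N \<and> b \<in> ?N \<and> a \<noteq> b)"
    using gr by (auto simp: simplicial_def complete_digraph_def ends set_eq_iff)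
  also have "\<dots> \<longleftrightarrow> v \<in> verts G \<and> (\<forall>a b. v \<rightarrow>\<^bsub>G\<^esub> a \<longrightarrow> v \<rightarrow>\<^bsub>G\<^esub> b \<longrightarrow> a \<noteq> b \<longrightarrow> a \<rightarrow>\<^bsub>G\<^esub> b)"
    by (simp add: N) (metis adj_not_same)
  finally show ?thesis .
qed

section \<open>Shortest paths and total general position sets\<close>

text \<open>If \<open>a\<close> and \<open>b\<close> were adjacent, leaving out \<open>z\<close>
  would give a path with the same ends and one arc fewer.\<close>

lemma shortest_path_bypass:
  assumes "graph G" and sp: "shortest_path G p w q" and w: "w = us @ a # z # b # vs"
  shows "\<not> a \<rightarrow>\<^bsub>G\<^esub> b"
proof
  assume ab: "a \<rightarrow>\<^bsub>G\<^esub> b"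
  \<comment> \<open>The bracketing places the junction between \<open>a\<close> and
    \<open>b\<close>, the only arc not inherited from \<open>w\<close>; \<open>append_assoc\<close>
    is switched off below to preserve it.\<close>
  let ?w = "(us @ [a]) @ b # vs"
  have vp: "vpath w G" and hl: "hd w = p" "last w = q"
    using sp by (auto simp: shortest_path_def)
  have "vwalk (us @ [a]) G" "vwalk (b # vs) G"
    using vp unfolding w
    by (auto intro: vwalkI_append_l[of _ "z # b # vs"] vwalkI_append_r[of _ "us @ [a, z]"]
        elim!: vpathE)
  hence "vwalk ?w G"
    using ab by (auto simp: vwalk_def vwalk_arcs_append simp del: append_assoc)
  moreover have "distinct ?w"
    using vp unfolding w by (auto elim!: vpathE)
  ultimately have "vpath ?w G" ..
  moreover have "hd ?w = p" "last ?w = q"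
    using hl unfolding w by (auto simp: hd_append)
  ultimately have "vwalk_length w \<le> vwalk_length ?w"
    using sp unfolding shortest_path_def by blast
  thus False
    unfolding w by simp
qed

text \<open>Supplies the predecessor and the successor of an internal vertex, in the form that
  \<open>shortest_path_bypass\<close> expects.\<close>

lemma internal_vertsE:
  assumes "z \<in> internal_verts w"
  obtains us a b vs where "w = us @ a # z # b # vs"
proof -
  have z: "z \<in> set w" "z \<noteq> hd w" "z \<noteq> last w"
    using assms by (auto simp: internal_verts_def)
  then obtain xs ys where w: "w = xs @ z # ys"
    by (meson split_list)
  with z have "xs \<noteq> []" "ys \<noteq> []"
    by auto
  then obtain us a b vs where "xs = us @ [a]" "ys = b # vs"
    by (cases xs rule: rev_cases; cases ys) auto
  with w show thesis
    by (intro that[of us a b vs]) simp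
qed

text \<open>The predecessor and the successor of \<open>z\<close> on the path would be distinct
  neighbours of \<open>z\<close>, hence adjacent, and \<open>z\<close> could be bypassed.\<close>

lemma simplicial_not_internal:
  assumes "graph G" "shortest_path G p w q" "simplicial G z"
  shows "z \<notin> internal_verts w"
proof
  interpret graph G by fact
  assume "z \<in> internal_verts w"
  then obtain us a b vs where w: "w = us @ a # z # b # vs"
    by (rule internal_vertsE)
  have vp: "vpath w G"
    using assms by (auto simp: shortest_path_def)
  hence "vwalk (a # z # b # vs) G"
    unfolding w vpath_def using vwalkI_append_r[of "a # z # b # vs" us G] by simp
  hence "z \<rightarrow>\<^bsub>G\<^esub> a" "z \<rightarrow>\<^bsub>G\<^esub> b"
    using arcs_ends_symmetric[OF sym_arcs] by auto
  moreover have "a \<noteq> b"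
    using vp unfolding w by (auto elim!: vpathE)
  ultimately have "a \<rightarrow>\<^bsub>G\<^esub> b"
    using assms(3) unfolding simplicial_iff[OF assms(1)] by blast
  thus False
    using shortest_path_bypass[OF assms(1,2) w] by simp
qed

text \<open>A path with fewer than two arcs has one or two vertices, which would force
  \<open>p = q\<close> or make \<open>p\<close> and \<open>q\<close> adjacent.\<close>

lemma shortest_path_two:
  assumes "graph G" "p \<rightarrow>\<^bsub>G\<^esub> z" "z \<rightarrow>\<^bsub>G\<^esub> q" "p \<noteq> q" "\<not> p \<rightarrow>\<^bsub>G\<^esub> q"
  shows "shortest_path G p [p, z, q] q"
proof -
  interpret graph G by fact
  have "vpath [p, z, q] G"
    using assms adj_in_verts adj_not_same by (auto intro!: vpathI)
  moreover have "2 \<le> vwalk_length w" if "vpath w G" "hd w = p" "last w = q" for w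
  proof (rule ccontr)
    assume "\<not> 2 \<le> vwalk_length w"
    hence "length w \<le> 2"
      by simp
    moreover have "w \<noteq> []"
      using that by (auto elim!: vpathE)
    ultimately consider a where "w = [a]" | a b where "w = [a, b]"
      by (cases w; cases "tl w") auto
    thus False
      using that assms by cases (auto simp: vpath_def)
  qed
  ultimately show ?thesis
    by (auto simp: shortest_path_def numeral_2_eq_2)
qed

text \<open>A non-simplicial \<open>z\<close> in \<open>Z\<close> has non-adjacent neighbours
  \<open>a\<close> and \<open>b\<close>, and \<open>[a, z, b]\<close> is a shortest path with
  \<open>z\<close> inside. Conversely, no shortest path has a simplicial internal vertex.\<close>

lemma total_general_position_iff:
  assumes "graph G"
  shows "total_general_position G Z \<longleftrightarrow> Z \<subseteq> {v. simplicial G v}"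
proof
  interpret graph G by fact
  assume Z: "total_general_position G Z"
  show "Z \<subseteq> {v. simplicial G v}"
  proof (rule ccontr)
    assume "\<not> Z \<subseteq> {v. simplicial G v}"
    then obtain z where z: "z \<in> Z" "\<not> simplicial G z"
      by auto
    moreover have "z \<in> verts G"
      using Z z by (auto simp: total_general_position_def)
    ultimately obtain a b where ab: "z \<rightarrow>\<^bsub>G\<^esub> a" "z \<rightarrow>\<^bsub>G\<^esub> b" "a \<noteq> b" "\<not> a \<rightarrow>\<^bsub>G\<^esub> b"
      using assms by (auto simp: simplicial_iff)
    hence "shortest_path G a [a, z, b] b"
      using arcs_ends_symmetric[OF sym_arcs] by (intro shortest_path_two[OF assms]) auto
    moreover have "a \<in> verts G" "b \<in> verts G"
      using ab adj_in_verts by auto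
    ultimately have "internal_verts [a, z, b] \<inter> Z = {}"
      using Z by (simp add: total_general_position_def positionable_def)
    moreover have "z \<in> internal_verts [a, z, b]"
      using ab adj_not_same by (auto simp: internal_verts_def)
    ultimately show False
      using z by auto
  qed
next
  assume Z: "Z \<subseteq> {v. simplicial G v}"
  hence "Z \<subseteq> verts G"
    by (auto simp: simplicial_def)
  moreover have "internal_verts w \<inter> Z = {}" if "shortest_path G p w q" for p q w
    using simplicial_not_internal[OF assms that] Z by blast
  ultimately show "total_general_position G Z"
    by (simp add: total_general_position_def positionable_def)
qed

lemma finite_simplicial:
  assumes "graph G"
  shows "finite {v. simplicial G v}"
proof -
  interpret graph G by fact
  show ?thesis
    by (rule finite_subset[OF _ finite_verts]) (auto simp: simplicial_def)
qed

text \<open>The sets over which \<open>gp_t\<close> maximises form the power set of a finite set, so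
  \<open>Max\<close> is taken over a finite set and attained at the full set.\<close>

lemma gp_t_eq:
  assumes "graph G"
  shows "gp_t G = card {v. simplicial G v}"
proof -
  let ?S = "{v. simplicial G v}"
  have fin: "finite ?S"
    using assms by (rule finite_simplicial)
  have "Max (card ` Pow ?S) = card ?S"
  proof (rule Max_eqI)
    show "finite (card ` Pow ?S)"
      using fin by (intro finite_imageI) (simp only: finite_Pow_iff)
    show "n \<le> card ?S" if "n \<in> card ` Pow ?S" for n
      using that card_mono[OF fin] by blast
    show "card ?S \<in> card ` Pow ?S"
      by (rule imageI) simp
  qed
  thus ?thesis
    by (simp only: gp_t_def total_general_position_iff[OF assms] Pow_def)
qed

section \<open>Deleting a vertex\<close>

lemma arcs_ends_del_vert:
  "arcs_ends (pre_digraph.del_vert G x) = {(u, v). u \<rightarrow>\<^bsub>G\<^esub> v \<and> u \<noteq> x \<and> v \<noteq> x}"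
  by (auto simp: arcs_ends_conv pre_digraph.del_vert_simps image_iff)

lemma graph_del_vert:
  assumes "graph G"
  shows "graph (pre_digraph.del_vert G x)"
proof -
  interpret graph G by fact
  have "digraph (del_vert x)"
    by unfold_locales (auto simp: del_vert_simps ends_del_vert no_loops intro: no_multi_arcs)
  moreover have "symmetric (del_vert x)"
    using arcs_ends_symmetric[OF sym_arcs]
    by (auto simp: symmetric_def arcs_ends_del_vert intro!: symI)
  ultimately show ?thesis
    by (rule digraph.graphI)
qed

text \<open>Deletion loses no arc between vertices other than \<open>x\<close>, so the condition can
  be read off from \<open>G\<close> itself and compared directly with
  \<open>simplicial_iff\<close>.\<close>

lemma simplicial_del_vert_iff:
  assumes "graph G"
  shows "simplicial (pre_digraph.del_vert G x) v \<longleftrightarrow> v \<in> verts G \<and> v \<noteq> x \<and>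
    (\<forall>a b. v \<rightarrow>\<^bsub>G\<^esub> a \<longrightarrow> v \<rightarrow>\<^bsub>G\<^esub> b \<longrightarrow> a \<noteq> x \<longrightarrow> b \<noteq> x \<longrightarrow> a \<noteq> b \<longrightarrow> a \<rightarrow>\<^bsub>G\<^esub> b)"
  using simplicial_iff[OF graph_del_vert[OF assms], of x v]
  by (auto simp: arcs_ends_del_vert pre_digraph.verts_del_vert)

text \<open>Every neighbour of \<open>x\<close> is the head of some arc leaving \<open>x\<close>,
  and \<open>out_degree\<close> counts these arcs.\<close>

lemma card_neighbourhood_le:
  assumes "graph G"
  shows "card (neighbourhood G x) \<le> out_degree G x"
proof -
  interpret graph G by fact
  have "neighbourhood G x \<subseteq> head G ` out_arcs G x"
    by (auto simp: neighbourhood_def)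
  hence "card (neighbourhood G x) \<le> card (head G ` out_arcs G x)"
    using finite_out_arcs by (intro card_mono) auto
  also have "\<dots> \<le> card (out_arcs G x)"
    using finite_out_arcs by (intro card_image_le) auto
  finally show ?thesis
    by (simp add: out_degree_def)
qed

text \<open>Only \<open>x\<close> itself can drop out: for any other vertex the condition after
  deletion quantifies over fewer neighbours.\<close>

lemma gp_t_le_del_vert:
  assumes "graph G"
  shows "gp_t G \<le> gp_t (pre_digraph.del_vert G x) + 1"
proof -
  let ?S = "{v. simplicial (pre_digraph.del_vert G x) v}"
  have fin: "finite ?S"
    by (intro finite_simplicial graph_del_vert assms)
  have "{v. simplicial G v} \<subseteq> insert x ?S"
    using assms by (auto simp: simplicial_iff simplicial_del_vert_iff)
  hence "card {v. simplicial G v} \<le> card (insert x ?S)"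
    using fin by (intro card_mono) auto
  also have "\<dots> \<le> card ?S + 1"
    using fin by (simp add: card_insert_if)
  finally show ?thesis
    by (simp add: gp_t_eq assms graph_del_vert)
qed

text \<open>A remaining vertex not adjacent to \<open>x\<close> keeps its neighbourhood, so its
  status does not change. Excluding \<open>x\<close> from the counted set lets this one estimate
  yield both upper bounds.\<close>

lemma gp_t_del_vert_le:
  assumes "graph G"
  shows "gp_t (pre_digraph.del_vert G x) \<le> card ({v. simplicial G v} - {x}) + out_degree G x"
proof -
  interpret graph G by fact
  let ?S = "{v. simplicial G v} - {x}"
  have "{v. simplicial (pre_digraph.del_vert G x) v} \<subseteq> ?S \<union> neighbourhood G x"
    using arcs_ends_symmetric[OF sym_arcs] assms
    by (auto simp: simplicial_iff simplicial_del_vert_iff neighbourhood_def)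
  moreover have "finite (neighbourhood G x)"
    by (rule finite_subset[OF _ finite_verts]) (auto simp: neighbourhood_def)
  ultimately have "gp_t (pre_digraph.del_vert G x) \<le> card (?S \<union> neighbourhood G x)"
    using finite_simplicial[OF assms]
    by (auto simp: gp_t_eq graph_del_vert assms intro: card_mono)
  also have "\<dots> \<le> card ?S + card (neighbourhood G x)"
    by (rule card_Un_le)
  finally show ?thesis
    using card_neighbourhood_le[OF assms, of x] by linarith
qed

section \<open>Connectivity from a single root\<close>

text \<open>Walks can be reversed in a symmetric graph, so any two vertices are joined through the
  root \<open>r\<close>.\<close>

lemma (in graph) reachable_via:
  assumes "\<And>v. v \<in> verts G \<Longrightarrow> r \<rightarrow>\<^sup>* v" "u \<in> verts G" "v \<in> verts G"
  shows "u \<rightarrow>\<^sup>* v"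
  using symmetric_reachable'[OF assms(1)[OF assms(2)]] assms(1)[OF assms(3)]
  by (rule reachable_trans)

lemma (in graph) connectedI_via:
  assumes "r \<in> verts G" "\<And>v. v \<in> verts G \<Longrightarrow> r \<rightarrow>\<^sup>* v"
  shows "Digraph_Component.connected G"
proof (rule connectedI)
  show "verts G \<noteq> {}"
    using assms(1) by blast
  show "u \<rightarrow>\<^sup>*\<^bsub>mk_symmetric G\<^esub> v" if "u \<in> verts G" "v \<in> verts G" for u v
    using reachable_via[OF assms(2) that] by (rule reachable_mk_symmetricI)
qed

text \<open>A root reaching everything that remains after deletion shows that no two remaining
  vertices are separated.\<close>

lemma not_cut_vertexI:
  assumes "graph G" "\<And>v. v \<in> verts G \<Longrightarrow> v \<noteq> x \<Longrightarrow> r \<rightarrow>\<^sup>*\<^bsub>pre_digraph.del_vert G x\<^esub> v"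
  shows "\<not> cut_vertex G x"
proof -
  interpret D: graph "pre_digraph.del_vert G x"
    using assms(1) by (rule graph_del_vert)
  have "u \<rightarrow>\<^sup>*\<^bsub>pre_digraph.del_vert G x\<^esub> v" if "u \<in> verts G - {x}" "v \<in> verts G - {x}" for u v
    by (rule D.reachable_via[of r]) (use that assms(2) in \<open>auto simp: pre_digraph.verts_del_vert\<close>)
  thus ?thesis
    unfolding cut_vertex_def by blast
qed

section \<open>Graphs attaining the bounds\<close>

definition K2 :: "nat pair_pre_digraph" where
  "K2 = \<lparr> pverts = {0, 1}, parcs = {(0, 1), (1, 0)} \<rparr>"

definition P3 :: "nat pair_pre_digraph" where
  "P3 = \<lparr> pverts = {0, 1, 2}, parcs = {(0, 1), (1, 0), (1, 2), (2, 1)} \<rparr>"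

definition C4 :: "nat pair_pre_digraph" where
  "C4 = \<lparr> pverts = {0, 1, 2, 3},
     parcs = {(0, 1), (1, 0), (1, 2), (2, 1), (2, 3), (3, 2), (3, 0), (0, 3)} \<rparr>"

text \<open>Arcs that are pairs of vertices cannot be parallel, so for the concrete examples the
  graph axioms reduce to properties of a finite relation.\<close>

lemma graph_with_projI:
  assumes "finite (pverts P)" "parcs P \<subseteq> pverts P \<times> pverts P" "irrefl (parcs P)" "sym (parcs P)"
  shows "graph (with_proj P)"
proof -
  have "finite (parcs P)"
    using assms by (meson finite_SigmaI finite_subset)
  hence "digraph (with_proj P)"
    using assms by unfold_locales (auto simp: irrefl_def arc_to_ends_def)
  thus ?thesis
    using assms by (intro digraph.graphI) (auto simp: symmetric_def)
qed

lemma K2_simps [simp]: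
  "pverts K2 = {0, 1}"
  "parcs K2 = {(0, 1), (1, 0)}"
  by (simp_all add: K2_def)

lemma graph_K2: "graph K2"
  by (rule graph_with_projI) (auto simp: irrefl_def sym_def)

lemma P3_simps [simp]:
  "pverts P3 = {0, 1, 2}"
  "parcs P3 = {(0, 1), (1, 0), (1, 2), (2, 1)}"
  by (simp_all add: P3_def)

lemma graph_P3: "graph P3"
  by (rule graph_with_projI) (auto simp: irrefl_def sym_def)

lemma C4_simps [simp]:
  "pverts C4 = {0, 1, 2, 3}"
  "parcs C4 = {(0, 1), (1, 0), (1, 2), (2, 1), (2, 3), (3, 2), (3, 0), (0, 3)}"
  by (simp_all add: C4_def)

lemma graph_C4: "graph C4"
  by (rule graph_with_projI) (auto simp: irrefl_def sym_def)

text \<open>Both vertices are simplicial; after the deletion the single vertex \<open>1\<close> is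
  so vacuously.\<close>

lemma sharp_K2:
  "Digraph_Component.connected K2" "\<not> cut_vertex K2 0"
  "gp_t K2 = 2" "gp_t (pre_digraph.del_vert K2 0) = 1"
proof -
  interpret graph K2 by (rule graph_K2)
  interpret D: graph "pre_digraph.del_vert K2 0" by (rule graph_del_vert[OF graph_K2])
  show "Digraph_Component.connected K2"
    by (rule connectedI_via[of 0]) auto
  show "\<not> cut_vertex K2 0"
    by (rule not_cut_vertexI[OF graph_K2, of _ 1]) (auto simp: pre_digraph.verts_del_vert)
  have "{v. simplicial K2 v} = {0, 1}"
    by (auto simp: simplicial_iff graph_K2)
  thus "gp_t K2 = 2"
    by (simp add: gp_t_eq graph_K2)
  have "{v. simplicial (pre_digraph.del_vert K2 0) v} = {1}"
    by (auto simp: simplicial_del_vert_iff graph_K2)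
  thus "gp_t (pre_digraph.del_vert K2 0) = 1"
    by (simp add: gp_t_eq graph_K2 graph_del_vert)
qed

text \<open>Each vertex of the cycle has two non-adjacent neighbours. Deleting \<open>0\<close>
  leaves the path \<open>1\<close>, \<open>2\<close>, \<open>3\<close>, whose simplicial ends are
  exactly the two neighbours of \<open>0\<close>.\<close>

lemma sharp_C4:
  "Digraph_Component.connected C4" "\<not> cut_vertex C4 0"
  "gp_t C4 = 0" "gp_t (pre_digraph.del_vert C4 0) = 2" "out_degree C4 0 = 2"
proof -
  interpret graph C4 by (rule graph_C4)
  interpret D: graph "pre_digraph.del_vert C4 0" by (rule graph_del_vert[OF graph_C4])
  \<comment> \<open>The root is the vertex opposite \<open>0\<close>: it survives the deletion,
    where it is adjacent to all other vertices, and in the cycle it reaches \<open>0\<close> through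
    \<open>1\<close>.\<close>
  have "2 \<rightarrow>\<^bsub>C4\<^esub> 1" "1 \<rightarrow>\<^bsub>C4\<^esub> 0" "2 \<rightarrow>\<^bsub>C4\<^esub> 3"
    by auto
  hence "2 \<rightarrow>\<^sup>*\<^bsub>C4\<^esub> v" if "v \<in> verts C4" for v
    using that adj_reachable_trans[of 2 1 0] by auto
  thus "Digraph_Component.connected C4"
    by (intro connectedI_via[of 2]) auto
  show "\<not> cut_vertex C4 0"
    by (rule not_cut_vertexI[OF graph_C4, of _ 2])
      (auto simp: pre_digraph.verts_del_vert arcs_ends_del_vert intro: D.reachable_adjI)
  have "{v. simplicial C4 v} = {}"
    by (auto simp: simplicial_iff graph_C4)
  thus "gp_t C4 = 0"
    by (simp add: gp_t_eq graph_C4)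
  have "{v. simplicial (pre_digraph.del_vert C4 0) v} = {1, 3}"
    by (auto simp: simplicial_del_vert_iff graph_C4)
  thus "gp_t (pre_digraph.del_vert C4 0) = 2"
    by (simp add: gp_t_eq graph_C4 graph_del_vert)
  have "out_arcs C4 0 = {(0, 1), (0, 3)}"
    by auto
  thus "out_degree C4 0 = 2"
    by (simp add: out_degree_def)
qed

text \<open>Deleting the end \<open>0\<close> loses one simplicial vertex, but the middle vertex
  \<open>1\<close> becomes an end and replaces it, so the count stays at two.\<close>

lemma sharp_P3:
  "Digraph_Component.connected P3" "\<not> cut_vertex P3 0" "simplicial P3 0"
  "gp_t P3 = 2" "gp_t (pre_digraph.del_vert P3 0) = 2" "out_degree P3 0 = 1"
proof -
  interpret graph P3 by (rule graph_P3)
  interpret D: graph "pre_digraph.del_vert P3 0" by (rule graph_del_vert[OF graph_P3])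
  show "Digraph_Component.connected P3"
    by (rule connectedI_via[of 1]) auto
  show "\<not> cut_vertex P3 0"
    by (rule not_cut_vertexI[OF graph_P3, of _ 1])
      (auto simp: pre_digraph.verts_del_vert arcs_ends_del_vert intro: D.reachable_adjI)
  have "{v. simplicial P3 v} = {0, 2}"
    by (auto simp: simplicial_iff graph_P3)
  thus "simplicial P3 0" "gp_t P3 = 2"
    by (auto simp: gp_t_eq graph_P3)
  have "{v. simplicial (pre_digraph.del_vert P3 0) v} = {1, 2}"
    by (auto simp: simplicial_del_vert_iff graph_P3)
  thus "gp_t (pre_digraph.del_vert P3 0) = 2"
    by (simp add: gp_t_eq graph_P3 graph_del_vert)
  have "out_arcs P3 0 = {(0, 1)}"
    by auto
  thus "out_degree P3 0 = 1"
    by (simp add: out_degree_def)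
qed

theorem theorem3p2:
  shows
    "(\<forall>(G :: ('a, 'b) pre_digraph) x.
        graph G \<and> Digraph_Component.connected G \<and> x \<in> verts G \<and> \<not> cut_vertex G x \<longrightarrow>
          int (gp_t G) - 1 \<le> int (gp_t (pre_digraph.del_vert G x)) \<and>
          int (gp_t (pre_digraph.del_vert G x)) \<le> int (gp_t G) + int (out_degree G x) \<and>
          (simplicial G x \<longrightarrow>
             int (gp_t (pre_digraph.del_vert G x)) \<le> int (gp_t G) + int (out_degree G x) - 1))
     \<and> (\<exists>(H :: (nat, nat \<times> nat) pre_digraph) y.
          graph H \<and> Digraph_Component.connected H \<and> y \<in> verts H \<and> \<not> cut_vertex H y \<and>
          verts (pre_digraph.del_vert H y) \<noteq> {} \<and>
          int (gp_t H) - 1 = int (gp_t (pre_digraph.del_vert H y)))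
     \<and> (\<exists>(H :: (nat, nat \<times> nat) pre_digraph) y.
          graph H \<and> Digraph_Component.connected H \<and> y \<in> verts H \<and> \<not> cut_vertex H y \<and>
          verts (pre_digraph.del_vert H y) \<noteq> {} \<and>
          int (gp_t (pre_digraph.del_vert H y)) = int (gp_t H) + int (out_degree H y))
     \<and> (\<exists>(H :: (nat, nat \<times> nat) pre_digraph) y.
          graph H \<and> Digraph_Component.connected H \<and> y \<in> verts H \<and> \<not> cut_vertex H y \<and>
          simplicial H y \<and>
          verts (pre_digraph.del_vert H y) \<noteq> {} \<and>
          int (gp_t (pre_digraph.del_vert H y)) = int (gp_t H) + int (out_degree H y) - 1)"
proof (intro conjI)
  show "\<forall>(G :: ('a, 'b) pre_digraph) x.
        graph G \<and> Digraph_Component.connected G \<and> x \<in> verts G \<and> \<not> cut_vertex G x \<longrightarrow>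
          int (gp_t G) - 1 \<le> int (gp_t (pre_digraph.del_vert G x)) \<and>
          int (gp_t (pre_digraph.del_vert G x)) \<le> int (gp_t G) + int (out_degree G x) \<and>
          (simplicial G x \<longrightarrow>
             int (gp_t (pre_digraph.del_vert G x)) \<le> int (gp_t G) + int (out_degree G x) - 1)"
  proof (intro allI impI, elim conjE)
    fix G :: "('a, 'b) pre_digraph" and x
    assume G: "graph G"
    let ?S = "{v. simplicial G v}"
    have le: "card (?S - {x}) \<le> gp_t G"
      unfolding gp_t_eq[OF G] by (rule card_Diff1_le)
    \<comment> \<open>Here \<open>x\<close> is itself one of the counted vertices; the strictness
      provides the extra \<open>- 1\<close> of the third bound.\<close>
    have less: "card (?S - {x}) < gp_t G" if "simplicial G x"
      unfolding gp_t_eq[OF G] using that by (intro card_Diff1_less finite_simplicial[OF G]) simp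
    show "int (gp_t G) - 1 \<le> int (gp_t (pre_digraph.del_vert G x)) \<and>
          int (gp_t (pre_digraph.del_vert G x)) \<le> int (gp_t G) + int (out_degree G x) \<and>
          (simplicial G x \<longrightarrow>
             int (gp_t (pre_digraph.del_vert G x)) \<le> int (gp_t G) + int (out_degree G x) - 1)"
      using gp_t_le_del_vert[OF G, of x] gp_t_del_vert_le[OF G, of x] le less by linarith
  qed
  show "\<exists>(H :: (nat, nat \<times> nat) pre_digraph) y.
          graph H \<and> Digraph_Component.connected H \<and> y \<in> verts H \<and> \<not> cut_vertex H y \<and>
          verts (pre_digraph.del_vert H y) \<noteq> {} \<and>
          int (gp_t H) - 1 = int (gp_t (pre_digraph.del_vert H y))"
    by (rule exI[of _ "with_proj K2"], rule exI[of _ 0])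
      (auto simp: graph_K2 sharp_K2 pre_digraph.verts_del_vert)
  show "\<exists>(H :: (nat, nat \<times> nat) pre_digraph) y.
          graph H \<and> Digraph_Component.connected H \<and> y \<in> verts H \<and> \<not> cut_vertex H y \<and>
          verts (pre_digraph.del_vert H y) \<noteq> {} \<and>
          int (gp_t (pre_digraph.del_vert H y)) = int (gp_t H) + int (out_degree H y)"
    by (rule exI[of _ "with_proj C4"], rule exI[of _ 0])
      (auto simp: graph_C4 sharp_C4 pre_digraph.verts_del_vert)
  show "\<exists>(H :: (nat, nat \<times> nat) pre_digraph) y.
          graph H \<and> Digraph_Component.connected H \<and> y \<in> verts H \<and> \<not> cut_vertex H y \<and>
          simplicial H y \<and>
          verts (pre_digraph.del_vert H y) \<noteq> {} \<and>
          int (gp_t (pre_digraph.del_vert H y)) = int (gp_t H) + int (out_degree H y) - 1"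
    by (rule exI[of _ "with_proj P3"], rule exI[of _ 0])
      (auto simp: graph_P3 sharp_P3 pre_digraph.verts_del_vert)
qed

end
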